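(* Let $(K,P,N)$ be a finite element with $P\subset\tilde P$ satisfying $P=\bigcap_{i=1}^\kappa\mathrm{null}(\lambda_i)$ for linearly independent functionals $\{\lambda_i\}_{i=1}^\kappa$. Define $$\tilde N=\begin{bmatrix}N\\ L\end{bmatrix}$$ to include the nodes of $N$ together with $L=\begin{bmatrix}\lambda_1&\lambda_2&\cdots&\lambda_\kappa\end{bmatrix}^T$. Then $(K,\tilde P,\tilde N)$ is a finite element.
   Context: For a domain $\Omega\subset\mathbb{R}^d$, $C_b^k(\Omega)$ is the space of functions with continuous and bounded derivatives up to and including order $k$ over $\Omega$, and $C_b^k(\Omega)'$ is its topological dual. A finite element is a triple $(K,P,N)$ where $K\subset\mathbb{R}^d$ is a bounded domain, $P\subset C_b^k(K)$ for some integer $k\ge 0$ is a finite-dimensional function space, and $N=\{n_i\}_{i=1}^\nu\subset C_b^k(K)'$ is a collection of linearly independent functionals (nodes) whose actions restricted to $P$ form a basis for $P'$. With a slight abuse of notation, $N$ also denotes the vector $[n_1\ n_2\ \cdots\ n_\nu]^T$. Here $\tilde P\subset C_b^k(K)$ is a larger function space containing $P$, and the $\lambda_i$ are linearly independent functionals in $C_b^k(K)'$ which are considered as acting on $\tilde P$: $\mathrm{null}(\lambda_i)=\{p\in\tilde P:\lambda_i(p)=0\}$.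
   Formalization: The functionals λ_i are required to be linearly independent as functionals acting on P̃, not merely in C_b^k(K)'; with the weaker requirement the claim fails, e.g. P̃ = P and a single nonzero λ vanishing on P. *)

theory Defs
  imports "HOL-Analysis.Analysis" "HOL-Library.Function_Algebras"
begin

text \<open>Real-valued functions form a real vector space under pointwise operations, so that
  \<open>subspace\<close>, \<open>span\<close> and \<open>independent\<close> apply both to functions and to functionals.\<close>

instantiation "fun" :: (type, real_vector) real_vector
begin

definition scaleR_fun :: "real \<Rightarrow> ('a \<Rightarrow> 'b) \<Rightarrow> 'a \<Rightarrow> 'b" where
  "scaleR_fun c f = (\<lambda>x. c *\<^sub>R f x)"

instance
  by standard
    (simp_all add: scaleR_fun_def plus_fun_def scaleR_add_right scaleR_add_left)

end

text \<open>A domain is a nonempty connected open set.\<close>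

definition bounded_domain :: "(real ^ 'd) set \<Rightarrow> bool" where
  "bounded_domain K \<longleftrightarrow> K \<noteq> {} \<and> open K \<and> connected K \<and> bounded K"

text \<open>Iterated partial derivatives: a list of coordinate indices plays the role of a multi-index,
  and its length is the order. The value is meaningful only at points where the derivatives
  involved exist.\<close>

fun partials :: "'d list \<Rightarrow> (real ^ 'd \<Rightarrow> real) \<Rightarrow> real ^ 'd \<Rightarrow> real" where
  "partials [] f = f"
| "partials (i # is) f = (\<lambda>x. frechet_derivative (partials is f) (at x) (axis i 1))"

text \<open>The space \<open>C\<^sub>b\<^sup>k(K)\<close>. A function on \<open>K\<close> is represented by its extension by \<open>0\<close> to the whole
  space, so that HOL equality is equality on \<open>K\<close>. As \<open>K\<close> is open, the extension does not
  affect derivatives at points of \<open>K\<close>.\<close>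

definition Cb :: "nat \<Rightarrow> (real ^ 'd) set \<Rightarrow> (real ^ 'd \<Rightarrow> real) set" where
  "Cb k K = {f. (\<forall>x. x \<notin> K \<longrightarrow> f x = 0) \<and>
     (\<forall>is. length is < k \<longrightarrow> partials is f differentiable_on K) \<and>
     (\<forall>is. length is \<le> k \<longrightarrow> continuous_on K (partials is f) \<and> bounded (partials is f ` K))}"

definition Cb_norm :: "nat \<Rightarrow> (real ^ 'd) set \<Rightarrow> (real ^ 'd \<Rightarrow> real) \<Rightarrow> real" where
  "Cb_norm k K f = (SUP (is, x) \<in> {is. length is \<le> k} \<times> K. \<bar>partials is f x\<bar>)"

text \<open>The topological dual of a subspace \<open>V\<close> of \<open>C\<^sub>b\<^sup>k(K)\<close>, normed by \<open>Cb_norm k K\<close>. Functionals are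
  extended by \<open>0\<close> outside \<open>V\<close> (in general a nonlinear extension), so that HOL equality is
  equality on \<open>V\<close>.\<close>

definition dual :: "nat \<Rightarrow> (real ^ 'd) set \<Rightarrow> (real ^ 'd \<Rightarrow> real) set
    \<Rightarrow> ((real ^ 'd \<Rightarrow> real) \<Rightarrow> real) set" where
  "dual k K V = {\<phi>. (\<forall>f. f \<notin> V \<longrightarrow> \<phi> f = 0) \<and>
     (\<forall>f\<in>V. \<forall>g\<in>V. \<phi> (f + g) = \<phi> f + \<phi> g) \<and>
     (\<forall>c. \<forall>f\<in>V. \<phi> (c *\<^sub>R f) = c * \<phi> f) \<and>
     (\<exists>C. \<forall>f\<in>V. \<bar>\<phi> f\<bar> \<le> C * Cb_norm k K f)}"

definition restrict_functional :: "'f set \<Rightarrow> ('f \<Rightarrow> real) \<Rightarrow> 'f \<Rightarrow> real" where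
  "restrict_functional V \<phi> = (\<lambda>f. if f \<in> V then \<phi> f else 0)"

definition null :: "'f set \<Rightarrow> ('f \<Rightarrow> real) \<Rightarrow> 'f set" where
  "null V \<phi> = {p \<in> V. \<phi> p = 0}"

text \<open>Linear independence of a finite family; a repeated entry makes the family dependent.\<close>

definition independent_list :: "'v::real_vector list \<Rightarrow> bool" where
  "independent_list vs \<longleftrightarrow> distinct vs \<and> independent (set vs)"

definition basis_list :: "'v::real_vector set \<Rightarrow> 'v list \<Rightarrow> bool" where
  "basis_list W vs \<longleftrightarrow> independent_list vs \<and> span (set vs) = W"

text \<open>The nodes are given as the vector \<open>[n\<^sub>1, \<dots>, n\<^sub>\<nu>]\<close>; \<open>k\<close> is the smoothness order for which
  \<open>P \<subseteq> C\<^sub>b\<^sup>k(K)\<close> and on which the nodes are bounded.\<close>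

definition finite_element :: "nat \<Rightarrow> (real ^ 'd) set \<Rightarrow> (real ^ 'd \<Rightarrow> real) set
    \<Rightarrow> ((real ^ 'd \<Rightarrow> real) \<Rightarrow> real) list \<Rightarrow> bool" where
  "finite_element k K P N \<longleftrightarrow>
     bounded_domain K \<and>
     P \<subseteq> Cb k K \<and> subspace P \<and> (\<exists>B. finite B \<and> P = span B) \<and>
     set N \<subseteq> dual k K (Cb k K) \<and> independent_list N \<and>
     basis_list (dual k K P) (map (restrict_functional P) N)"

end

theory Submission
  imports Defs
begin

text \<open>Two facts about the restriction from \<open>Ptilde\<close> to \<open>P\<close> carry the proof. It is a linear map on
  functionals, and its kernel on the dual of \<open>Ptilde\<close> is the span of the \<open>\<lambda>\<^sub>i\<close>, because a functional
  that vanishes on the common null space of finitely many functionals is a combination of them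
  (\<open>in_span_if_vanishes_on_common_null\<close>).

  Unisolvence then is the usual gluing of a basis of the kernel and a lifted basis of the image.
  If \<open>\<phi>\<close> is dual to \<open>Ptilde\<close>, its restriction to \<open>P\<close> is a combination of nodes in \<open>N\<close>; subtracting
  that combination on all of \<open>Ptilde\<close> leaves a functional vanishing on \<open>P\<close>, hence a combination
  of \<open>L\<close>. A linear relation among \<open>N\<close> and \<open>L\<close> on \<open>Ptilde\<close> restricts to one among \<open>N\<close> alone
  on \<open>P\<close>, so its \<open>N\<close>-coefficients vanish, and then its \<open>L\<close>-coefficients do
  (\<open>independent_list_append\<close>). Finally, \<open>Ptilde\<close> is finite-dimensional because each \<open>\<lambda>\<^sub>i\<close> cuts the
  dimension by at most one (\<open>finite_dim_if_common_null\<close>).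

  Boundedness of functionals enters only through closure under linear combinations and restriction:
  functionals in the span of the nodes are bounded, and the representation of a given functional
  by nodes is pure linear algebra.\<close>

section \<open>Independence relative to a linear map\<close>

text \<open>A relation among \<open>xs @ ys\<close> is mapped by \<open>T\<close> to one among \<open>map T xs\<close>, which is trivial; what
  remains is a relation among \<open>ys\<close>. For \<open>ys = []\<close> this says that independence lifts
  along linear maps.\<close>

lemma independent_list_append:
  assumes T: "linear T"
    and xs: "independent_list (map T xs)"
    and ys: "independent_list ys" and ker: "\<And>y. y \<in> set ys \<Longrightarrow> T y = 0"
  shows "independent_list (xs @ ys)"
proof -
  have inj: "inj_on T (set xs)" and dx: "distinct xs"
    using xs by (auto simp: independent_list_def distinct_map)
  have ix: "independent (T ` set xs)" and iy: "independent (set ys)" and dy: "distinct ys"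
    using xs ys by (auto simp: independent_list_def)
  have "T x \<noteq> 0" if "x \<in> set xs" for x
    using ix that dependent_zero by (metis imageI)
  with ker have disj: "set xs \<inter> set ys = {}" by blast
  have "independent (set xs \<union> set ys)"
  proof (rule independent_if_scalars_zero)
    fix u v assume rel: "(\<Sum>v\<in>set xs \<union> set ys. u v *\<^sub>R v) = 0" and v: "v \<in> set xs \<union> set ys"
    have split: "(\<Sum>v\<in>set xs. u v *\<^sub>R v) + (\<Sum>v\<in>set ys. u v *\<^sub>R v) = 0"
      using rel disj by (simp add: sum.union_disjoint)
    have "T (\<Sum>v\<in>set ys. u v *\<^sub>R v) = 0"
      using ker by (simp add: linear_sum[OF T] linear_scale[OF T])
    then have "T (\<Sum>v\<in>set xs. u v *\<^sub>R v) = 0"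
      using arg_cong[OF split, of T] by (simp add: linear_add[OF T] linear_0[OF T])
    then have "(\<Sum>v\<in>set xs. u v *\<^sub>R T v) = 0"
      by (simp add: linear_sum[OF T] linear_scale[OF T])
    then have "(\<Sum>w\<in>T ` set xs. u (inv_into (set xs) T w) *\<^sub>R w) = 0"
      by (simp add: sum.reindex[OF inj] inv_into_f_f[OF inj])
    then have ux: "u x = 0" if "x \<in> set xs" for x
      using independentD[OF ix finite_imageI[OF finite_set] subset_refl, of _ "T x"] that
      by (force simp: inv_into_f_f[OF inj])
    with split have "(\<Sum>v\<in>set ys. u v *\<^sub>R v) = 0" by simp
    then have "u y = 0" if "y \<in> set ys" for y
      using independentD[OF iy finite_set subset_refl] that by blast
    with ux v show "u v = 0" by blast
  qed simp
  with dx dy disj show ?thesis by (simp add: independent_list_def)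
qed

section \<open>Common null spaces of finitely many functionals\<close>

text \<open>The value \<open>0\<close> outside \<open>V\<close> makes equality of functionals mean equality on \<open>V\<close>, as in \<open>dual\<close>.\<close>

definition algebraic_dual :: "'v::real_vector set \<Rightarrow> ('v \<Rightarrow> real) set" where
  "algebraic_dual V = {\<phi>. (\<forall>f. f \<notin> V \<longrightarrow> \<phi> f = 0) \<and>
     (\<forall>f\<in>V. \<forall>g\<in>V. \<phi> (f + g) = \<phi> f + \<phi> g) \<and> (\<forall>c. \<forall>f\<in>V. \<phi> (c *\<^sub>R f) = c * \<phi> f)}"

lemma algebraic_dual_add: "\<lbrakk>\<phi> \<in> algebraic_dual V; f \<in> V; g \<in> V\<rbrakk> \<Longrightarrow> \<phi> (f + g) = \<phi> f + \<phi> g"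
  and algebraic_dual_scale: "\<lbrakk>\<phi> \<in> algebraic_dual V; f \<in> V\<rbrakk> \<Longrightarrow> \<phi> (c *\<^sub>R f) = c * \<phi> f"
  by (auto simp: algebraic_dual_def)

lemma algebraic_dual_zero: "\<lbrakk>\<phi> \<in> algebraic_dual V; subspace V\<rbrakk> \<Longrightarrow> \<phi> 0 = 0"
  using algebraic_dual_scale[of \<phi> V 0 0] by (simp add: subspace_0)

lemma algebraic_dual_diff_scale:
  assumes "\<phi> \<in> algebraic_dual V" "subspace V" "f \<in> V" "g \<in> V"
  shows "\<phi> (f - c *\<^sub>R g) = \<phi> f - c * \<phi> g"
  using algebraic_dual_add[OF assms(1,3) subspace_scale[OF assms(2,4)], of "- c"]
    algebraic_dual_scale[OF assms(1,4), of "- c"]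
  by simp

lemma subspace_algebraic_dual: "subspace (algebraic_dual V)"
  by (rule subspaceI) (auto simp: algebraic_dual_def scaleR_fun_def algebra_simps)

lemma subspace_common_null:
  assumes "subspace V" "Ls \<subseteq> algebraic_dual V"
  shows "subspace (V \<inter> (\<Inter>l\<in>Ls. null V l))"
proof -
  have "subspace (V \<inter> null V l)" if "l \<in> Ls" for l
    using assms that
    by (intro subspaceI)
       (auto simp: null_def subspace_0 subspace_add subspace_scale algebraic_dual_zero
         algebraic_dual_add[of l V] algebraic_dual_scale[of l V])
  then have "subspace (V \<inter> (\<Inter>l\<in>Ls. V \<inter> null V l))"
    using assms(1) by (intro subspace_inter subspace_Inter) auto
  moreover have "V \<inter> (\<Inter>l\<in>Ls. V \<inter> null V l) = V \<inter> (\<Inter>l\<in>Ls. null V l)" by auto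
  ultimately show ?thesis by simp
qed

text \<open>The null space of a single functional \<open>l\<close> has codimension at most one: \<open>p \<mapsto> p - l p *\<^sub>R w\<close> is a
  projection onto it. When \<open>l\<close> vanishes on \<open>W\<close>, the choice \<open>w = 0\<close> covers that case too, so
  that the applications need no case distinction.\<close>

lemma null_projection:
  assumes V: "subspace V" and l: "l \<in> algebraic_dual V" and W: "subspace W" "W \<subseteq> V"
  obtains w where "w \<in> W" "\<And>p. p \<in> W \<Longrightarrow> p - l p *\<^sub>R w \<in> W \<inter> null V l"
proof (cases "\<exists>v\<in>W. l v \<noteq> 0")
  case False
  then show ?thesis
    using that[of 0] W by (auto simp: null_def subspace_0)
next
  case True
  then obtain v where v: "v \<in> W" "l v \<noteq> 0" by blast
  define w where "w = (1 / l v) *\<^sub>R v"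
  have w: "w \<in> W" "l w = 1"
    using v W algebraic_dual_scale[OF l, of v] by (auto simp: w_def subspace_scale)
  show ?thesis
  proof (rule that[OF w(1)])
    fix p assume p: "p \<in> W"
    then have "p - l p *\<^sub>R w \<in> W" using w(1) W(1) by (intro subspace_diff subspace_scale)
    moreover have "l (p - l p *\<^sub>R w) = 0"
      using algebraic_dual_diff_scale[OF l V, of p w "l p"] p w W(2) by auto
    ultimately show "p - l p *\<^sub>R w \<in> W \<inter> null V l" using W(2) by (auto simp: null_def)
  qed
qed

lemma common_null_insert_Int:
  "V \<inter> (\<Inter>m\<in>insert l Ls. null V m) = (V \<inter> (\<Inter>m\<in>Ls. null V m)) \<inter> null V l"
  by auto

text \<open>Induction on the number of functionals: with \<open>w\<close> chosen by \<open>null_projection\<close> for the new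
  functional \<open>l\<close>, the functional \<open>\<psi> - \<psi> w *\<^sub>R l\<close> vanishes where all the earlier ones do.\<close>

lemma in_span_if_vanishes_on_common_null:
  assumes V: "subspace V" and "finite Ls" "Ls \<subseteq> algebraic_dual V" "\<psi> \<in> algebraic_dual V"
    and "\<And>p. p \<in> V \<inter> (\<Inter>l\<in>Ls. null V l) \<Longrightarrow> \<psi> p = 0"
  shows "\<psi> \<in> span Ls"
  using assms(2-)
proof (induction Ls arbitrary: \<psi> rule: finite_induct)
  case empty
  then have "\<psi> p = 0" for p
    by (cases "p \<in> V") (auto simp: algebraic_dual_def)
  then have "\<psi> = 0" unfolding zero_fun_def by (rule ext)
  then show ?case by (simp only: span_zero)
next
  case (insert l Ls)
  let ?W = "V \<inter> (\<Inter>l\<in>Ls. null V l)"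
  have l: "l \<in> algebraic_dual V" and Ls: "Ls \<subseteq> algebraic_dual V" using insert.prems by auto
  obtain w where w: "w \<in> ?W" "\<And>p. p \<in> ?W \<Longrightarrow> p - l p *\<^sub>R w \<in> ?W \<inter> null V l"
    using null_projection[OF V l subspace_common_null[OF V Ls] Int_lower1] by blast
  have "\<psi> - \<psi> w *\<^sub>R l \<in> span Ls"
  proof (rule insert.IH[OF Ls])
    show "\<psi> - \<psi> w *\<^sub>R l \<in> algebraic_dual V"
      by (intro subspace_diff subspace_scale subspace_algebraic_dual insert.prems l)
    fix p assume p: "p \<in> ?W"
    have "\<psi> (p - l p *\<^sub>R w) = 0"
      by (rule insert.prems(3)) (use w(2)[OF p] in \<open>simp only: common_null_insert_Int\<close>)
    then show "(\<psi> - \<psi> w *\<^sub>R l) p = 0"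
      using algebraic_dual_diff_scale[OF insert.prems(2) V, of p w "l p"] p w(1)
      by (simp add: scaleR_fun_def mult.commute)
  qed
  then have "\<psi> - \<psi> w *\<^sub>R l \<in> span (insert l Ls)"
    using span_mono[of Ls "insert l Ls"] by blast
  then show ?case
    using span_add[OF _ span_scale[OF span_base], of "\<psi> - \<psi> w *\<^sub>R l" "insert l Ls" l "\<psi> w"] by simp
qed

text \<open>Removing one functional enlarges the common null space by at most the direction \<open>w\<close> of
  \<open>null_projection\<close>.\<close>

lemma finite_dim_if_common_null:
  assumes V: "subspace V" and "finite Ls" "Ls \<subseteq> algebraic_dual V"
    and "finite B" "V \<inter> (\<Inter>l\<in>Ls. null V l) = span B"
  shows "\<exists>B. finite B \<and> V = span B"
  using assms(2-)
proof (induction Ls arbitrary: B rule: finite_induct)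
  case empty
  then show ?case by auto
next
  case (insert l Ls)
  let ?W = "V \<inter> (\<Inter>l\<in>Ls. null V l)"
  have l: "l \<in> algebraic_dual V" and Ls: "Ls \<subseteq> algebraic_dual V" using insert.prems by auto
  have W: "subspace ?W" by (rule subspace_common_null[OF V Ls])
  have B: "?W \<inter> null V l = span B" using insert.prems(3) by (simp only: common_null_insert_Int)
  obtain w where w: "w \<in> ?W" "\<And>p. p \<in> ?W \<Longrightarrow> p - l p *\<^sub>R w \<in> ?W \<inter> null V l"
    using null_projection[OF V l W Int_lower1] by blast
  have "?W = span (insert w B)"
  proof
    show "?W \<subseteq> span (insert w B)"
    proof
      fix p assume "p \<in> ?W"
      then have "p - l p *\<^sub>R w \<in> span B" unfolding B[symmetric] by (rule w(2))
      then show "p \<in> span (insert w B)" unfolding span_breakdown_eq by (rule exI)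
    qed
    have "B \<subseteq> ?W" using B span_superset[of B] by blast
    with w(1) show "span (insert w B) \<subseteq> ?W"
      by (intro span_minimal W) blast
  qed
  with insert.IH[OF Ls, of "insert w B"] insert.prems(2) show ?case by simp
qed

section \<open>Restriction and the topological dual\<close>

lemma dual_eq: "dual k K V = {\<phi> \<in> algebraic_dual V. \<exists>C. \<forall>f\<in>V. \<bar>\<phi> f\<bar> \<le> C * Cb_norm k K f}"
  by (auto simp: dual_def algebraic_dual_def)

lemma subspace_dual: "subspace (dual k K V)"
proof (rule subspaceI)
  show "0 \<in> dual k K V"
    by (auto simp: dual_eq subspace_0[OF subspace_algebraic_dual] intro: exI[of _ 0])
next
  fix \<phi> \<psi> assume \<phi>: "\<phi> \<in> dual k K V" and \<psi>: "\<psi> \<in> dual k K V"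
  then obtain C D where "\<forall>f\<in>V. \<bar>\<phi> f\<bar> \<le> C * Cb_norm k K f" "\<forall>f\<in>V. \<bar>\<psi> f\<bar> \<le> D * Cb_norm k K f"
    by (auto simp: dual_eq)
  then have "\<forall>f\<in>V. \<bar>(\<phi> + \<psi>) f\<bar> \<le> (C + D) * Cb_norm k K f"
    by (fastforce simp: distrib_right)
  with \<phi> \<psi> show "\<phi> + \<psi> \<in> dual k K V"
    using subspace_add[OF subspace_algebraic_dual] unfolding dual_eq by blast
next
  fix c \<phi> assume \<phi>: "\<phi> \<in> dual k K V"
  then obtain C where C: "\<forall>f\<in>V. \<bar>\<phi> f\<bar> \<le> C * Cb_norm k K f"
    by (auto simp: dual_eq)
  have "\<bar>(c *\<^sub>R \<phi>) f\<bar> \<le> (\<bar>c\<bar> * C) * Cb_norm k K f" if "f \<in> V" for f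
    using mult_left_mono[OF C[rule_format, OF that], of "\<bar>c\<bar>"]
    by (simp add: scaleR_fun_def abs_mult mult.assoc)
  with \<phi> show "c *\<^sub>R \<phi> \<in> dual k K V"
    using subspace_scale[OF subspace_algebraic_dual] unfolding dual_eq by blast
qed

lemma linear_restrict_functional: "linear (restrict_functional V)"
  by (rule linearI) (auto simp: restrict_functional_def scaleR_fun_def fun_eq_iff)

lemma restrict_functional_restrict:
  "P \<subseteq> V \<Longrightarrow> restrict_functional P (restrict_functional V \<phi>) = restrict_functional P \<phi>"
  by (auto simp: restrict_functional_def fun_eq_iff)

lemma restrict_functional_in_dual:
  assumes "\<phi> \<in> dual k K V" "P \<subseteq> V" "subspace P"
  shows "restrict_functional P \<phi> \<in> dual k K P"
proof -
  obtain C where "\<forall>f\<in>V. \<bar>\<phi> f\<bar> \<le> C * Cb_norm k K f"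
    using assms(1) by (auto simp: dual_def)
  then have "\<forall>f\<in>P. \<bar>restrict_functional P \<phi> f\<bar> \<le> C * Cb_norm k K f"
    using assms(2) by (auto simp: restrict_functional_def)
  then show ?thesis
    using assms
    by (auto simp: dual_def restrict_functional_def subspace_add subspace_scale subset_eq)
qed

section \<open>Enriching a finite element\<close>

text \<open>Independence is needed in the dual of \<open>C\<^sub>b\<^sup>k(K)\<close> and in that of \<open>Ptilde\<close>; the former follows from
  the latter, since restriction is linear and any relation survives it.\<close>

theorem proposition4p2:
  fixes k :: nat and K :: "(real ^ 'd) set"
    and P Ptilde :: "(real ^ 'd \<Rightarrow> real) set"
    and N L :: "((real ^ 'd \<Rightarrow> real) \<Rightarrow> real) list"
  assumes "finite_element k K P N"
    and "subspace Ptilde" and "Ptilde \<subseteq> Cb k K" and "P \<subseteq> Ptilde"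
    and "set L \<subseteq> dual k K (Cb k K)"
    and "independent_list (map (restrict_functional Ptilde) L)"
    and "P = Ptilde \<inter> (\<Inter>l\<in>set L. null Ptilde l)"
  shows "finite_element k K Ptilde (N @ L)"
proof -
  let ?R = "restrict_functional Ptilde" and ?r = "restrict_functional P"
  let ?N = "map ?R N" and ?L = "map ?R L"
  note fe = assms(1)[unfolded finite_element_def basis_list_def]
  have K: "bounded_domain K" and P: "subspace P"
    and N: "set N \<subseteq> dual k K (Cb k K)"
    and N_indep: "independent_list (map ?r N)" and N_span: "span (set (map ?r N)) = dual k K P"
    using fe by auto
  obtain B where B: "finite B" "P = span B" using fe by blast
  have r_R: "?r (?R \<phi>) = ?r \<phi>" for \<phi>
    by (rule restrict_functional_restrict[OF assms(4)])
  have NL_dual: "set (?N @ ?L) \<subseteq> dual k K Ptilde"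
    using N assms(5) restrict_functional_in_dual[OF _ assms(3,2)] by auto
  then have L_alg: "set ?L \<subseteq> algebraic_dual Ptilde" by (auto simp: dual_eq)
  have P_eq: "P = Ptilde \<inter> (\<Inter>l\<in>set ?L. null Ptilde l)"
    using assms(7) by (auto simp: null_def restrict_functional_def)

  have fin: "\<exists>B. finite B \<and> Ptilde = span B"
    using finite_dim_if_common_null[OF assms(2) finite_set L_alg B(1)] P_eq B(2) by simp

  have "?r l = 0" if "l \<in> set ?L" for l
    using P_eq that by (auto simp: restrict_functional_def fun_eq_iff null_def)
  moreover have "independent_list (map ?r ?N)"
    using N_indep by (simp add: r_R comp_def)
  ultimately have NL_indep: "independent_list (?N @ ?L)"
    using assms(6) by (intro independent_list_append[OF linear_restrict_functional[of P]])
  have "independent_list ((N @ L) @ [])"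
    by (rule independent_list_append[OF linear_restrict_functional[of Ptilde]])
      (use NL_indep in \<open>auto simp: independent_list_def independent_empty\<close>)
  then have indep: "independent_list (N @ L)" by simp

  have "dual k K Ptilde \<subseteq> span (set (?N @ ?L))"
  proof
    fix \<phi> assume \<phi>: "\<phi> \<in> dual k K Ptilde"
    have "?r \<phi> \<in> span (?r ` set ?N)"
      using restrict_functional_in_dual[OF \<phi> assms(4) P] N_span by (simp add: image_image r_R)
    also have "\<dots> = ?r ` span (set ?N)"
      by (rule linear_span_image[OF linear_restrict_functional])
    finally obtain \<eta> where \<eta>: "\<eta> \<in> span (set ?N)" "?r \<phi> = ?r \<eta>"
      by blast
    have "\<eta> \<in> dual k K Ptilde"
      using \<eta>(1) span_minimal[OF _ subspace_dual, of "set ?N"] NL_dual by auto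
    with \<phi> have "\<phi> - \<eta> \<in> algebraic_dual Ptilde"
      using subspace_diff[OF subspace_algebraic_dual] by (auto simp: dual_eq)
    moreover have "(\<phi> - \<eta>) p = 0" if "p \<in> P" for p
      using fun_cong[OF \<eta>(2), of p] that by (simp add: restrict_functional_def)
    ultimately have "\<phi> - \<eta> \<in> span (set ?L)"
      using P_eq by (intro in_span_if_vanishes_on_common_null[OF assms(2) finite_set L_alg]) auto
    then have "\<phi> - \<eta> \<in> span (set (?N @ ?L))" "\<eta> \<in> span (set (?N @ ?L))"
      using \<eta>(1) span_mono[of "set ?L" "set (?N @ ?L)"] span_mono[of "set ?N" "set (?N @ ?L)"]
      by auto
    then have "\<phi> - \<eta> + \<eta> \<in> span (set (?N @ ?L))"
      by (rule span_add)
    then show "\<phi> \<in> span (set (?N @ ?L))" by simp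
  qed
  then have "span (set (?N @ ?L)) = dual k K Ptilde"
    using span_minimal[OF NL_dual subspace_dual] by blast
  with NL_indep have "basis_list (dual k K Ptilde) (map ?R (N @ L))"
    by (simp add: basis_list_def)
  with K assms(2,3,5) fin N indep show ?thesis
    by (simp add: finite_element_def)
qed

end
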